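(* Let $G$ and $G'$ be two graphs on the same vertex set $V$ (possibly infinite), and let $k$ be an integer with $k\geq 5$, $k\equiv 1\pmod 4$, and $k\leq |V|-2$ (void if $V$ is infinite). Then the following are equivalent: (i) for every $k$-element subset $K$ of $V$, $e(G_{\restriction K})$ and $e(G'_{\restriction K})$ have the same parity, and $G$ and $G'$ have the same $3$-homogeneous subsets; (ii) $G'=G$ or $G'=\overline G$.
   Context: A graph is a pair $G=(V,E)$ with $E$ a set of 2-element subsets of $V$; $\overline G$ is its complement, $G_{\restriction K}$ the subgraph induced on $K$, and $e(H)$ the number of edges of $H$. A triangle of $G$ is a 3-element subset of $V$ all of whose pairs are edges of $G$; a $3$-homogeneous subset of $G$ is a 3-element subset of $V$ that is a triangle of $G$ or of $\overline G$. *)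

theory Defs
  imports "HOL-Library.Ramsey"
begin

text \<open>A graph is a pair \<open>(V, E)\<close>; \<open>[A]\<^bsup>n\<^esup>\<close> is the library notation for the set of
  \<open>n\<close>-element subsets of \<open>A\<close>.\<close>

type_synonym 'a graph = "'a set \<times> 'a set set"

definition is_graph :: "'a graph \<Rightarrow> bool" where
  "is_graph G \<longleftrightarrow> snd G \<subseteq> [fst G]\<^bsup>2\<^esup>"

definition compl_graph :: "'a graph \<Rightarrow> 'a graph" where
  "compl_graph G = (fst G, [fst G]\<^bsup>2\<^esup> - snd G)"

definition induced :: "'a graph \<Rightarrow> 'a set \<Rightarrow> 'a graph" where
  "induced G K = (K, snd G \<inter> [K]\<^bsup>2\<^esup>)"

text \<open>Only meaningful for graphs with finitely many edges.\<close>

definition num_edges :: "'a graph \<Rightarrow> nat" where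
  "num_edges H = card (snd H)"

definition triangle :: "'a graph \<Rightarrow> 'a set \<Rightarrow> bool" where
  "triangle G T \<longleftrightarrow> T \<in> [fst G]\<^bsup>3\<^esup> \<and> [T]\<^bsup>2\<^esup> \<subseteq> snd G"

definition homogeneous3 :: "'a graph \<Rightarrow> 'a set \<Rightarrow> bool" where
  "homogeneous3 G T \<longleftrightarrow>
     T \<in> [fst G]\<^bsup>3\<^esup> \<and> (triangle G T \<or> triangle (compl_graph G) T)"

end

theory Submission
  imports Defs
begin

text \<open>Let \<open>D\<close> be the symmetric difference of the two edge sets, so that every \<open>k\<close>-set spans an
  even number of edges of \<open>D\<close>. Adding up the four \<open>k\<close>-sets obtained from a \<open>(k-2)\<close>-set by adjoining
  one of \<open>x, y\<close> and one of \<open>z, w\<close> shows that every 4-cycle has an even number of edges in \<open>D\<close>.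
  Hence all triples span the same number of edges of \<open>D\<close> mod 2, i.e. \<open>D\<close> or its complement is a cut \<open>(A, B)\<close>. If both
  sides are nonempty, no triple meeting both sides can be homogeneous, so a vertex of \<open>A\<close> is
  joined in \<open>G\<close> to exactly one of any two vertices of \<open>B\<close> and vice versa; so both sides have
  at most two elements, which is impossible on five vertices.\<close>

lemma nsets_2_insert:
  assumes "x \<notin> C"
  shows "[insert x C]\<^bsup>2\<^esup> = [C]\<^bsup>2\<^esup> \<union> (\<lambda>c. {x, c}) ` C"
  using assms by (auto simp: nsets_2_eq insert_commute)

lemma card_edges_insert:
  assumes "finite C" "x \<notin> C"
  shows "card (D \<inter> [insert x C]\<^bsup>2\<^esup>) = card (D \<inter> [C]\<^bsup>2\<^esup>) + card {c \<in> C. {x, c} \<in> D}"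
proof -
  let ?N = "(\<lambda>c. {x, c}) ` {c \<in> C. {x, c} \<in> D}"
  have "D \<inter> [insert x C]\<^bsup>2\<^esup> = (D \<inter> [C]\<^bsup>2\<^esup>) \<union> ?N"
    using assms(2) by (auto simp: nsets_2_insert)
  moreover have "(D \<inter> [C]\<^bsup>2\<^esup>) \<inter> ?N = {}"
    using assms(2) by (auto simp: nsets_def)
  moreover have "finite (D \<inter> [C]\<^bsup>2\<^esup>)" "finite ?N"
    using assms(1) by (auto intro: finite_imp_finite_nsets)
  moreover have "card ?N = card {c \<in> C. {x, c} \<in> D}"
    by (rule card_image) (auto simp: inj_on_def doubleton_eq_iff)
  ultimately show ?thesis
    by (simp add: card_Un_disjoint)
qed

lemma card_edges_insert2:
  assumes "finite C" "x \<notin> C" "z \<notin> C" "x \<noteq> z"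
  shows "card (D \<inter> [insert x (insert z C)]\<^bsup>2\<^esup>) =
    card (D \<inter> [C]\<^bsup>2\<^esup>) + card {c \<in> C. {z, c} \<in> D} + card {c \<in> C. {x, c} \<in> D} + of_bool ({x, z} \<in> D)"
proof -
  have "{c \<in> insert z C. {x, c} \<in> D} =
      (if {x, z} \<in> D then insert z {c \<in> C. {x, c} \<in> D} else {c \<in> C. {x, c} \<in> D})"
    by auto
  then show ?thesis
    using assms by (simp add: card_edges_insert)
qed

text \<open>Nested equivalences of Booleans record a parity: the 4-cycle through x, z, y, w has an
  even number of edges in \<open>D\<close>. This form lets the later argument be purely
  propositional.\<close>

lemma even_four_cycle:
  assumes even: "\<And>K. K \<in> [V]\<^bsup>k\<^esup> \<Longrightarrow> even (card (D \<inter> [K]\<^bsup>2\<^esup>))"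
    and k: "k \<ge> 2" "finite V \<Longrightarrow> k + 2 \<le> card V"
    and V: "{x, y, z, w} \<subseteq> V" and dist: "distinct [x, y, z, w]"
  shows "({x, z} \<in> D \<longleftrightarrow> {y, z} \<in> D) \<longleftrightarrow> ({x, w} \<in> D \<longleftrightarrow> {y, w} \<in> D)"
proof -
  \<comment> \<open>The bound \<open>k + 2 \<le> card V\<close> leaves at least k - 2 points outside
    the four given ones.\<close>
  have "\<exists>C. C \<subseteq> V - {x, y, z, w} \<and> card C = k - 2 \<and> finite C"
  proof (cases "finite V")
    case True
    have "card (V - {x, y, z, w}) = card V - 4"
      using V dist by (simp add: card_Diff_subset)
    then have "k - 2 \<le> card (V - {x, y, z, w})"
      using k(2)[OF True] by simp
    then show ?thesis
      by (metis obtain_subset_with_card_n)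
  next
    case False
    then have "infinite (V - {x, y, z, w})"
      by simp
    then show ?thesis
      using infinite_arbitrarily_large by metis
  qed
  then obtain C where C: "C \<subseteq> V - {x, y, z, w}" "card C = k - 2" "finite C"
    by blast
  have "even (card (D \<inter> [C]\<^bsup>2\<^esup>) + card {c \<in> C. {v, c} \<in> D} + card {c \<in> C. {u, c} \<in> D}
      + of_bool ({u, v} \<in> D))" if "u \<in> {x, y}" "v \<in> {z, w}" for u v
  proof -
    have uv: "u \<notin> C" "v \<notin> C" "u \<noteq> v"
      using that C(1) dist by auto
    have "insert u (insert v C) \<in> [V]\<^bsup>k\<^esup>"
      using uv that C V k(1) by (auto simp: nsets_def)
    then show ?thesis
      using even card_edges_insert2[OF C(3) uv, of D] by metis
  qed
  \<comment> \<open>In the sum of the four even numbers, the edges inside \<open>C\<close> count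
    four times and those from each of x, y, z, w to \<open>C\<close> twice. Modulo 2 only the four
    cross pairs remain.\<close>
  from this[of x z] this[of y z] this[of x w] this[of y w] show ?thesis
    by (auto split: if_splits)
qed

text \<open>If the cut were nontrivial on the five points, one side would contain three of them and
  the other some p. For q, r on the larger side, passing from \<open>g\<close> to \<open>g'\<close>
  flips either both pairs at p or only the pair q, r. As neither graph is constant on the triple,
  \<open>g p q\<close> and \<open>g p r\<close> differ; three Boolean values cannot differ
  pairwise.\<close>

lemma cut_trivial_on_five_points:
  fixes g g' :: "'a \<Rightarrow> 'a \<Rightarrow> bool"
  assumes sym: "\<And>x y. g x y = g y x" "\<And>x y. g' x y = g' y x"
    and cycle: "\<And>x y z w. \<lbrakk>{x, y, z, w} \<subseteq> S; distinct [x, y, z, w]\<rbrakk> \<Longrightarrow>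
      ((g x z = g' x z) = (g y z = g' y z)) = ((g x w = g' x w) = (g y w = g' y w))"
    and hom: "\<And>x y z. \<lbrakk>{x, y, z} \<subseteq> S; distinct [x, y, z]\<rbrakk> \<Longrightarrow>
      (g x y = g x z \<and> g x y = g y z) = (g' x y = g' x z \<and> g' x y = g' y z)"
    and S: "{a, b, c, d, e} \<subseteq> S" "distinct [a, b, c, d, e]"
  shows "(g a b = g' a b) = (g a c = g' a c)"
proof -
  \<comment> \<open>Orienting all pairs alphabetically leaves ten atoms per graph for
    \<open>sat\<close>.\<close>
  note s = sym[of b a] sym[of c a] sym[of d a] sym[of e a] sym[of c b] sym[of d b] sym[of e b]
    sym[of d c] sym[of e c] sym[of e d]
  have h: "(g a b = g a c \<and> g a b = g b c) = (g' a b = g' a c \<and> g' a b = g' b c)"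
    "(g a b = g a d \<and> g a b = g b d) = (g' a b = g' a d \<and> g' a b = g' b d)"
    "(g a b = g a e \<and> g a b = g b e) = (g' a b = g' a e \<and> g' a b = g' b e)"
    "(g a c = g a d \<and> g a c = g c d) = (g' a c = g' a d \<and> g' a c = g' c d)"
    "(g a c = g a e \<and> g a c = g c e) = (g' a c = g' a e \<and> g' a c = g' c e)"
    "(g a d = g a e \<and> g a d = g d e) = (g' a d = g' a e \<and> g' a d = g' d e)"
    "(g b c = g b d \<and> g b c = g c d) = (g' b c = g' b d \<and> g' b c = g' c d)"
    "(g b c = g b e \<and> g b c = g c e) = (g' b c = g' b e \<and> g' b c = g' c e)"
    "(g b d = g b e \<and> g b d = g d e) = (g' b d = g' b e \<and> g' b d = g' d e)"
    "(g c d = g c e \<and> g c d = g d e) = (g' c d = g' c e \<and> g' c d = g' d e)"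
    by (rule hom; use S in simp)+
  \<comment> \<open>The even-size part of the cycle space of the complete graph on five points has
    dimension 5. These five independent 4-cycles span it, so they imply the relations for all
    fifteen.\<close>
  have "((g a c = g' a c) = (g b c = g' b c)) = ((g a d = g' a d) = (g b d = g' b d))"
    "((g a c = g' a c) = (g b c = g' b c)) = ((g a e = g' a e) = (g b e = g' b e))"
    "((g a b = g' a b) = (g c b = g' c b)) = ((g a d = g' a d) = (g c d = g' c d))"
    "((g a b = g' a b) = (g c b = g' c b)) = ((g a e = g' a e) = (g c e = g' c e))"
    "((g a b = g' a b) = (g d b = g' d b)) = ((g a e = g' a e) = (g d e = g' d e))"
    by (rule cycle; use S in auto)+
  with h show ?thesis
    unfolding s by sat
qed

text \<open>Turns homogeneity into the equations required by \<open>hom\<close> in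
  \<open>cut_trivial_on_five_points\<close>.\<close>

lemma homogeneous3_triple:
  assumes "is_graph G" "{x, y, z} \<subseteq> fst G" "distinct [x, y, z]"
  shows "homogeneous3 G {x, y, z} \<longleftrightarrow>
    ({x, y} \<in> snd G) = ({x, z} \<in> snd G) \<and> ({x, y} \<in> snd G) = ({y, z} \<in> snd G)"
proof -
  have "[{x, y, z}]\<^bsup>2\<^esup> = {{x, y}, {x, z}, {y, z}}"
    using assms(3) by (auto simp: nsets_2_eq insert_commute)
  then show ?thesis
    using assms by (auto simp: homogeneous3_def triangle_def compl_graph_def nsets_def)
qed

lemma compl_compl_graph: "is_graph G \<Longrightarrow> compl_graph (compl_graph G) = G"
  by (cases G) (auto simp: is_graph_def compl_graph_def)

lemma homogeneous3_compl:
  assumes "is_graph G"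
  shows "homogeneous3 (compl_graph G) T \<longleftrightarrow> homogeneous3 G T"
  using compl_compl_graph[OF assms]
  by (auto simp: homogeneous3_def compl_graph_def)

lemma even_card_symmetric_difference:
  assumes "finite A" "finite B"
  shows "even (card (sym_diff A B)) \<longleftrightarrow> (even (card A) \<longleftrightarrow> even (card B))"
proof -
  have "card A = card (A - B) + card (A \<inter> B)" "card B = card (B - A) + card (A \<inter> B)"
    using assms by (metis card_Diff_subset_Int card_Int_Diff add.commute Int_commute finite_Int)+
  moreover have "card (sym_diff A B) = card (A - B) + card (B - A)"
    using assms by (intro card_Un_disjoint) auto
  ultimately show ?thesis
    by auto
qed

lemma even_choose_2:
  assumes "k mod 4 = (1::nat)"
  shows "even (k choose 2)"
proof -
  obtain m where "k = 4 * m + 1"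
    using assms by (metis mod_mult_div_eq add.commute)
  then show ?thesis
    by (simp add: choose_two)
qed

text \<open>The two edge counts add up to \<open>k choose 2\<close>, which is even: for k = 4m + 1
  it equals 2m(4m + 1).\<close>

lemma num_edges_compl_parity:
  assumes "is_graph G" "K \<in> [fst G]\<^bsup>k\<^esup>" "k \<ge> 1" "k mod 4 = 1"
  shows "even (num_edges (induced (compl_graph G) K)) \<longleftrightarrow> even (num_edges (induced G K))"
proof -
  have K: "K \<subseteq> fst G" "finite K" "card K = k"
    using assms(2) by (auto simp: nsets_def)
  let ?A = "snd G \<inter> [K]\<^bsup>2\<^esup>" and ?B = "([fst G]\<^bsup>2\<^esup> - snd G) \<inter> [K]\<^bsup>2\<^esup>"
  have fin: "finite ([K]\<^bsup>2\<^esup>)"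
    using K by (simp add: finite_imp_finite_nsets)
  have "[K]\<^bsup>2\<^esup> = ?A \<union> ?B"
    using nsets_mono[OF K(1)] by auto
  then have "card ?A + card ?B = k choose 2"
    using fin K card_nsets[of K 2] card_Un_disjoint[of ?A ?B] by fastforce
  then have "even (card ?A + card ?B)"
    using even_choose_2[OF assms(4)] by simp
  then show ?thesis
    by (auto simp: num_edges_def induced_def compl_graph_def)
qed

text \<open>Membership in \<open>D\<close> passes between pairs sharing a point, and disjoint pairs
  {a, b} and {c, d} are linked through {a, c}.\<close>

lemma constant_on_edges:
  assumes adj: "\<And>a b c. \<lbrakk>{a, b, c} \<subseteq> V; distinct [a, b, c]\<rbrakk> \<Longrightarrow> {a, b} \<in> D \<longleftrightarrow> {a, c} \<in> D"
    and "D \<subseteq> [V]\<^bsup>2\<^esup>"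
  shows "D = {} \<or> D = [V]\<^bsup>2\<^esup>"
proof (rule ccontr)
  assume "\<not> ?thesis"
  then obtain e f where "e \<in> D" "f \<in> [V]\<^bsup>2\<^esup>" "f \<notin> D"
    using assms(2) by blast
  moreover from this obtain a b c d where
    "e = {a, b}" "a \<in> V" "b \<in> V" "a \<noteq> b" "f = {c, d}" "c \<in> V" "d \<in> V" "c \<noteq> d"
    using assms(2) by (auto simp: nsets_2_eq dest!: subsetD)
  ultimately have abcd: "{a, b, c, d} \<subseteq> V" "a \<noteq> b" "c \<noteq> d" "{a, b} \<in> D" "{c, d} \<notin> D"
    by auto
  have meet: "{x, y} \<in> D \<longleftrightarrow> {x, z} \<in> D" if "{x, y, z} \<subseteq> V" "x \<noteq> y" "x \<noteq> z" for x y z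
    using that adj[of x y z] by (cases "y = z") auto
  show False
  proof (cases "a = c")
    case True
    then show False
      using abcd meet[of a b d] by auto
  next
    case False
    then show False
      using abcd meet[of a b c] meet[of c a d] by (auto simp: insert_commute)
  qed
qed

theorem theorem2p12:
  fixes V :: "'a set" and G G' :: "'a graph" and k :: nat
  assumes "is_graph G" and "is_graph G'"
    and "fst G = V" and "fst G' = V"
    and "k \<ge> 5" and "k mod 4 = 1"
    and "finite V \<Longrightarrow> k + 2 \<le> card V"
  shows "((\<forall>K \<in> [V]\<^bsup>k\<^esup>. even (num_edges (induced G K)) \<longleftrightarrow> even (num_edges (induced G' K)))
            \<and> {T. homogeneous3 G T} = {T. homogeneous3 G' T})
         \<longleftrightarrow> (G' = G \<or> G' = compl_graph G)"
    (is "?L \<longleftrightarrow> ?R")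
proof
  assume ?R
  then show ?L
    using assms num_edges_compl_parity[OF assms(1)] homogeneous3_compl[OF assms(1)] by auto
next
  assume L: ?L
  define D where "D = sym_diff (snd G) (snd G')"
  have D_iff: "e \<in> D \<longleftrightarrow> (e \<in> snd G) \<noteq> (e \<in> snd G')" for e
    by (auto simp: D_def)
  have sub: "snd G \<subseteq> [V]\<^bsup>2\<^esup>" "snd G' \<subseteq> [V]\<^bsup>2\<^esup>"
    using assms by (auto simp: is_graph_def)
  have even: "even (card (D \<inter> [K]\<^bsup>2\<^esup>))" if "K \<in> [V]\<^bsup>k\<^esup>" for K
  proof -
    have "finite ([K]\<^bsup>2\<^esup>)"
      using that by (auto simp: nsets_def intro: finite_imp_finite_nsets)
    then have "even (card (sym_diff (snd G \<inter> [K]\<^bsup>2\<^esup>) (snd G' \<inter> [K]\<^bsup>2\<^esup>)))"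
      using L that by (subst even_card_symmetric_difference) (auto simp: num_edges_def induced_def)
    moreover have "sym_diff (snd G \<inter> [K]\<^bsup>2\<^esup>) (snd G' \<inter> [K]\<^bsup>2\<^esup>) = D \<inter> [K]\<^bsup>2\<^esup>"
      by (auto simp: D_def)
    ultimately show ?thesis
      by simp
  qed
  have "{a, b} \<in> D \<longleftrightarrow> {a, c} \<in> D" if abc: "{a, b, c} \<subseteq> V" "distinct [a, b, c]" for a b c
  proof -
    \<comment> \<open>A finite \<open>V\<close> has at least 7 points, so a, b, c extend to five
      distinct ones.\<close>
    have "\<not> V \<subseteq> F" if "finite F" "card F \<le> 4" for F
      using that assms(5,7) card_mono[of F V] finite_subset[of V F] by linarith
    then have fresh: "\<exists>v \<in> V. v \<notin> F" if "finite F" "card F \<le> 4" for F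
      using that by blast
    obtain d where d: "d \<in> V" "d \<notin> {a, b, c}"
      using fresh[of "{a, b, c}"] abc by auto
    obtain e where e: "e \<in> V" "e \<notin> {a, b, c, d}"
      using fresh[of "{a, b, c, d}"] abc d by auto
    have "(({a, b} \<in> snd G) = ({a, b} \<in> snd G')) = (({a, c} \<in> snd G) = ({a, c} \<in> snd G'))"
    proof (rule cut_trivial_on_five_points[where S = V and d = d and e = e
          and g = "\<lambda>x y. {x, y} \<in> snd G" and g' = "\<lambda>x y. {x, y} \<in> snd G'"])
      fix x y z w
      assume "{x, y, z, w} \<subseteq> V" "distinct [x, y, z, w]"
      from even_four_cycle[OF even _ assms(7) this] assms(5)
      show "((({x, z} \<in> snd G) = ({x, z} \<in> snd G')) = (({y, z} \<in> snd G) = ({y, z} \<in> snd G'))) =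
          ((({x, w} \<in> snd G) = ({x, w} \<in> snd G')) = (({y, w} \<in> snd G) = ({y, w} \<in> snd G')))"
        \<comment> \<open>Agreement of the graphs is non-membership in \<open>D\<close>; negating
          all four terms preserves the parity relation.\<close>
        unfolding D_iff by auto
    next
      fix x y z
      assume "{x, y, z} \<subseteq> V" "distinct [x, y, z]"
      then show "(({x, y} \<in> snd G) = ({x, z} \<in> snd G) \<and> ({x, y} \<in> snd G) = ({y, z} \<in> snd G)) =
          (({x, y} \<in> snd G') = ({x, z} \<in> snd G') \<and> ({x, y} \<in> snd G') = ({y, z} \<in> snd G'))"
        using homogeneous3_triple[of G x y z] homogeneous3_triple[of G' x y z] assms L by blast
    qed (use abc d e in \<open>auto simp: insert_commute\<close>)
    then show ?thesis
      unfolding D_iff by blast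
  qed
  moreover have "D \<subseteq> [V]\<^bsup>2\<^esup>"
    using sub by (auto simp: D_def)
  ultimately have "D = {} \<or> D = [V]\<^bsup>2\<^esup>"
    by (rule constant_on_edges)
  then have "snd G' = snd G \<or> snd G' = [V]\<^bsup>2\<^esup> - snd G"
    using sub D_iff by blast
  then show ?R
    using assms(3,4) by (auto simp: compl_graph_def prod_eq_iff)
qed

end
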